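(* Let $B_w$ be a hypercyclic weighted backward shift on the space $H(\mathbb{C})$ of entire functions, considered as a Fréchet sequence algebra under the Hadamard product. Then the set $HC(B_w)$ of hypercyclic vectors for $B_w$ is algebrable. This applies, in particular, to the MacLane operator $D$ of differentiation, $Df=f'$.
   Context: $H(\mathbb{C})$ carries the topology of uniform convergence on compact sets and is identified with a space of sequences via Taylor coefficients at $0$, $f(z)=\sum_{n\ge0}a_nz^n\leftrightarrow(a_n)_{n\ge0}$. The topology is induced by the seminorms $\|(a_n)_n\|_q=\sum_{n=0}^\infty|a_n|q^n$, $q\ge1$. The Hadamard product is $(f*g)(z)=\sum_{n=0}^\infty a_nb_nz^n$ for $f(z)=\sum_n a_nz^n$, $g(z)=\sum_n b_nz^n$, i.e. coordinatewise multiplication of the coefficient sequences. A weight is a sequence $w=(w_n)_{n\ge0}$ of non-zero complex numbers, with the convention $w_0=1$. The weighted backward shift is $B_w(a_0,a_1,a_2,\dots)=(w_1a_1,w_2a_2,w_3a_3,\dots)$; saying that it is a weighted backward shift on $X=H(\mathbb{C})$ means that it maps $X$ into $X$ (it is then a continuous linear operator on $X$). The operator $D$ is the weighted backward shift with $w_n=n$, $n\ge1$. $HC(T)=\{x\in X:\{x,Tx,T^2x,\dots\}\text{ is dense in }X\}$, and $T$ is hypercyclic if $HC(T)\neq\varnothing$. $HC(T)$ is algebrable if $HC(T)\cup\{0\}$ contains a subalgebra of $X$ (here for the Hadamard product) that is infinitely but not finitely generated. Algebras are not required to be unital; the algebra generated by a set is the smallest subalgebra containing it (the linear span of all finite products of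 at least one element of the set), and an algebra is finitely generated if it is generated by a finite subset. *)

theory Defs
  imports "HOL-Complex_Analysis.Complex_Analysis"
begin

definition entire :: "(complex \<Rightarrow> complex) set" where
  "entire = {f. f holomorphic_on UNIV}"

text \<open>The topology of uniform convergence on compact sets. As \<open>K\<close> is compact, requiring
  \<open>dist (g z) (f z) < e\<close> at every point of \<open>K\<close> is the same as bounding the maximum on \<open>K\<close>.\<close>

definition entire_topology :: "(complex \<Rightarrow> complex) topology" where
  "entire_topology = topology_generated_by
     {{g \<in> entire. \<forall>z\<in>K. dist (g z) (f z) < e} | f K e. f \<in> entire \<and> compact K \<and> e > (0::real)}"

definition taylor_coeffs :: "(complex \<Rightarrow> complex) \<Rightarrow> nat \<Rightarrow> complex" where
  "taylor_coeffs f n = (deriv ^^ n) f 0 / fact n"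

text \<open>Inverse of \<^const>\<open>taylor_coeffs\<close> on Taylor sequences of entire functions; no meaning is
  attached to its value on other sequences.\<close>

definition power_series :: "(nat \<Rightarrow> complex) \<Rightarrow> complex \<Rightarrow> complex" where
  "power_series a z = (\<Sum>n. a n * z ^ n)"

definition hadamard :: "(complex \<Rightarrow> complex) \<Rightarrow> (complex \<Rightarrow> complex) \<Rightarrow> complex \<Rightarrow> complex" where
  "hadamard f g = power_series (\<lambda>n. taylor_coeffs f n * taylor_coeffs g n)"

definition weight :: "(nat \<Rightarrow> complex) \<Rightarrow> bool" where
  "weight w \<longleftrightarrow> w 0 = 1 \<and> (\<forall>n. w n \<noteq> 0)"

definition seq_shift :: "(nat \<Rightarrow> complex) \<Rightarrow> (nat \<Rightarrow> complex) \<Rightarrow> nat \<Rightarrow> complex" where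
  "seq_shift w a n = w (Suc n) * a (Suc n)"

definition backward_shift :: "(nat \<Rightarrow> complex) \<Rightarrow> (complex \<Rightarrow> complex) \<Rightarrow> complex \<Rightarrow> complex" where
  "backward_shift w f = power_series (seq_shift w (taylor_coeffs f))"

text \<open>\<open>B\<^sub>w\<close> maps the space of entire functions into itself. This is stated on coefficient
  sequences since a divergent \<^const>\<open>power_series\<close> would still be a total function.\<close>

definition backward_shift_on_entire :: "(nat \<Rightarrow> complex) \<Rightarrow> bool" where
  "backward_shift_on_entire w \<longleftrightarrow>
     weight w \<and> (\<forall>f\<in>entire. seq_shift w (taylor_coeffs f) \<in> taylor_coeffs ` entire)"

definition HC :: "((complex \<Rightarrow> complex) \<Rightarrow> complex \<Rightarrow> complex) \<Rightarrow> (complex \<Rightarrow> complex) set" where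
  "HC T = {f \<in> entire. entire_topology closure_of (range (\<lambda>n. (T ^^ n) f)) = entire}"

definition hypercyclic :: "((complex \<Rightarrow> complex) \<Rightarrow> complex \<Rightarrow> complex) \<Rightarrow> bool" where
  "hypercyclic T \<longleftrightarrow> HC T \<noteq> {}"

text \<open>Not required to be unital.\<close>

definition subalgebra :: "(complex \<Rightarrow> complex) set \<Rightarrow> bool" where
  "subalgebra A \<longleftrightarrow> A \<subseteq> entire \<and> (\<lambda>z. 0) \<in> A \<and>
     (\<forall>f\<in>A. \<forall>g\<in>A. (\<lambda>z. f z + g z) \<in> A) \<and>
     (\<forall>c. \<forall>f\<in>A. (\<lambda>z. c * f z) \<in> A) \<and>
     (\<forall>f\<in>A. \<forall>g\<in>A. hadamard f g \<in> A)"

definition generates :: "(complex \<Rightarrow> complex) set \<Rightarrow> (complex \<Rightarrow> complex) set \<Rightarrow> bool" where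
  "generates S A \<longleftrightarrow> S \<subseteq> entire \<and> subalgebra hull S = A"

definition algebrable :: "(complex \<Rightarrow> complex) set \<Rightarrow> bool" where
  "algebrable M \<longleftrightarrow> (\<exists>A. subalgebra A \<and> A \<subseteq> M \<union> {\<lambda>z. 0} \<and>
     (\<exists>S. infinite S \<and> generates S A) \<and> \<not> (\<exists>S. finite S \<and> generates S A))"

definition MacLane_weight :: "nat \<Rightarrow> complex" where
  "MacLane_weight n = (if n = 0 then 1 else of_nat n)"

end

theory Submission
  imports Defs "HOL-Computational_Algebra.Fundamental_Theorem_Algebra"
begin

text \<open>Write \<open>v\<^sub>n = w\<^sub>1 \<cdots> w\<^sub>n\<close>. A dense orbit forces \<open>v\<^sub>n\<close> to grow faster than every \<open>Q\<^sup>n\<close> on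
  arbitrarily long windows of indices arbitrarily far out. A very sparse sequence \<open>b\<close> is placed on
  such windows, each of which gets a label \<open>i\<close>, an exponent \<open>l\<close> and a finite list of targets
  \<open>y\<^sub>0, y\<^sub>1, \<dots>\<close> from a countable dense set; on the window starting at \<open>N\<close> one solves
  \<open>v\<^bsub>N+m\<^esub> b\<^bsub>N+m\<^esub>\<^sup>l = v\<^sub>m y\<^sub>m\<close>. The restrictions \<open>f\<^sub>i\<close> of \<open>b\<close> to the windows labelled \<open>i\<close>
  have disjoint supports, so they generate the algebra of all finite sums \<open>\<Sum>\<^sub>i P\<^sub>i(f\<^sub>i)\<close> with
  \<open>P\<^sub>i(0) = 0\<close>. If \<open>P\<^sub>i = c x\<^sup>l + \<dots>\<close> is nonzero, then, \<open>b\<close> being small, shifting such a sum by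
  a window start \<open>N\<close> with label \<open>i\<close> and exponent \<open>l\<close> approximates \<open>\<Sum>\<^sub>m c y\<^sub>m z\<^sup>m\<close>, and the
  later windows contribute little because \<open>w\<close> grows at most exponentially. So every nonzero element
  is hypercyclic. Finitely many elements only involve finitely many \<open>f\<^sub>i\<close>, so they do not generate
  the algebra.\<close>

section \<open>Entire functions and their Taylor coefficients\<close>

lemma entire_holomorphic_on: "f \<in> entire \<Longrightarrow> f holomorphic_on A"
  by (simp add: entire_def holomorphic_on_subset[OF _ subset_UNIV])

lemma entire_continuous_on: "f \<in> entire \<Longrightarrow> continuous_on A f"
  by (intro holomorphic_on_imp_continuous_on entire_holomorphic_on)

text \<open>Boundedness at radius \<open>2 * r\<close> gives geometric decay at radius
  \<open>r\<close>, hence convergence everywhere. This turns entireness into growth bounds on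
  coefficients.\<close>

lemma conv_radius_infty_iff_bounded:
  fixes a :: "nat \<Rightarrow> complex"
  shows "conv_radius a = \<infinity> \<longleftrightarrow> (\<forall>r>0. \<exists>C. \<forall>n. norm (a n) * r ^ n \<le> C)"
proof
  assume a: "conv_radius a = \<infinity>"
  show "\<forall>r>0. \<exists>C. \<forall>n. norm (a n) * r ^ n \<le> C"
  proof (intro allI impI)
    fix r :: real assume "r > 0"
    have "summable (\<lambda>n. a n * of_real r ^ n)"
      by (rule summable_in_conv_radius) (simp add: a)
    then have "Bseq (\<lambda>n. a n * of_real r ^ n)"
      by (meson Bseq_conv_Bfun convergentI convergent_imp_Bseq summable_LIMSEQ_zero)
    then obtain C where "\<And>n. norm (a n * of_real r ^ n) \<le> C"
      unfolding Bseq_def by blast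
    then show "\<exists>C. \<forall>n. norm (a n) * r ^ n \<le> C"
      using \<open>r > 0\<close> by (auto simp: norm_mult norm_power)
  qed
next
  assume bdd: "\<forall>r>0. \<exists>C. \<forall>n. norm (a n) * r ^ n \<le> C"
  show "conv_radius a = \<infinity>"
  proof (rule conv_radius_inftyI'')
    fix z :: complex
    define r where "r = norm z + 1"
    have r: "r > 0" by (simp add: r_def add_nonneg_pos)
    obtain C where C: "\<And>n. norm (a n) * (2 * r) ^ n \<le> C"
      using bdd r by (metis mult_pos_pos zero_less_numeral)
    show "summable (\<lambda>n. a n * z ^ n)"
    proof (rule summable_comparison_test'[where N = 0 and g = "\<lambda>n. C * (1/2) ^ n"])
      show "summable (\<lambda>n. C * (1/2) ^ n)"
        by (intro summable_mult summable_geometric) simp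
      fix n :: nat
      have "norm (a n * z ^ n) \<le> norm (a n) * r ^ n"
        by (simp add: norm_mult norm_power r_def mult_left_mono power_mono)
      also have "\<dots> = (norm (a n) * (2 * r) ^ n) * (1/2) ^ n"
        by (simp add: power_mult_distrib power_divide)
      also have "\<dots> \<le> C * (1/2) ^ n"
        by (intro mult_right_mono C) auto
      finally show "norm (a n * z ^ n) \<le> C * (1/2) ^ n" .
    qed
  qed
qed

lemma conv_radius_infty_if_eventually_le:
  fixes a :: "nat \<Rightarrow> complex"
  assumes "\<And>r. r > 0 \<Longrightarrow> \<exists>n0. \<forall>n\<ge>n0. norm (a n) * r ^ n \<le> 1"
  shows "conv_radius a = \<infinity>"
  unfolding conv_radius_infty_iff_bounded
proof (intro allI impI)
  fix r :: real assume "r > 0"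
  then obtain n0 where n0: "\<And>n. n \<ge> n0 \<Longrightarrow> norm (a n) * r ^ n \<le> 1"
    using assms by blast
  let ?C = "Max ((\<lambda>n. norm (a n) * r ^ n) ` {..n0})"
  have "norm (a n) * r ^ n \<le> max 1 ?C" for n
  proof (cases "n \<ge> n0")
    case False
    then have "norm (a n) * r ^ n \<le> ?C" by (intro Max_ge) auto
    then show ?thesis by simp
  qed (use n0[of n] in simp)
  then show "\<exists>C. \<forall>n. norm (a n) * r ^ n \<le> C" by blast
qed

lemma conv_radius_infty_comparison:
  fixes a b :: "nat \<Rightarrow> complex"
  assumes "conv_radius b = \<infinity>" "\<And>n. norm (a n) \<le> C * norm (b n)"
  shows "conv_radius a = \<infinity>"
  unfolding conv_radius_infty_iff_bounded
proof (intro allI impI)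
  fix r :: real assume r: "r > 0"
  then obtain B where B: "\<And>n. norm (b n) * r ^ n \<le> B"
    using assms(1) unfolding conv_radius_infty_iff_bounded by blast
  have "norm (a n) * r ^ n \<le> \<bar>C\<bar> * B" for n
  proof -
    have "norm (a n) \<le> \<bar>C\<bar> * norm (b n)"
      by (rule order_trans[OF assms(2)]) (simp add: mult_right_mono)
    then have "norm (a n) * r ^ n \<le> \<bar>C\<bar> * norm (b n) * r ^ n"
      using r by (intro mult_right_mono) auto
    also have "\<dots> \<le> \<bar>C\<bar> * B"
      using mult_left_mono[OF B[of n], of "\<bar>C\<bar>"] by (simp add: mult_ac)
    finally show ?thesis .
  qed
  then show "\<exists>C. \<forall>n. norm (a n) * r ^ n \<le> C" by blast
qed

section \<open>Entire functions as coefficient sequences\<close>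

lemma power_series_sums:
  assumes "conv_radius a = \<infinity>"
  shows "(\<lambda>n. a n * z ^ n) sums power_series a z"
  unfolding power_series_def
  by (rule summable_sums, rule summable_in_conv_radius) (simp add: assms)

lemma power_series_entire:
  assumes "conv_radius a = \<infinity>"
  shows "power_series a \<in> entire"
proof -
  have "power_series a holomorphic_on ball 0 r" for r
    by (rule power_series_holomorphic[where a = a]) (simp add: power_series_sums[OF assms])
  then have "power_series a field_differentiable at z" for z
    by (metis centre_in_ball dist_0_norm holomorphic_on_imp_differentiable_at less_add_one
        mem_ball open_ball)
  then show ?thesis
    by (simp add: entire_def holomorphic_on_def field_differentiable_at_within)
qed

lemma taylor_coeffs_power_series:
  assumes "conv_radius a = \<infinity>"
  shows "taylor_coeffs (power_series a) = a"
proof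
  fix n
  have "power_series a has_fps_expansion Abs_fps a"
    unfolding has_fps_expansion_def fps_conv_radius_def
    by (auto simp: assms eval_fps_def power_series_def)
  then show "taylor_coeffs (power_series a) n = a n"
    using fps_nth_fps_expansion[of "power_series a" "Abs_fps a" n] by (simp add: taylor_coeffs_def)
qed

lemma taylor_coeffs_sums:
  assumes "f \<in> entire"
  shows "(\<lambda>n. taylor_coeffs f n * z ^ n) sums f z"
  using holomorphic_power_series[OF entire_holomorphic_on[OF assms], of z 0 "norm z + 1"]
  by (simp add: taylor_coeffs_def)

lemma conv_radius_taylor_coeffs:
  assumes "f \<in> entire"
  shows "conv_radius (taylor_coeffs f) = \<infinity>"
  by (rule conv_radius_inftyI'') (rule sums_summable[OF taylor_coeffs_sums[OF assms]])

lemma power_series_taylor_coeffs: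
  assumes "f \<in> entire"
  shows "power_series (taylor_coeffs f) = f"
proof
  show "power_series (taylor_coeffs f) z = f z" for z
    using taylor_coeffs_sums[OF assms, of z] by (simp add: power_series_def sums_iff)
qed

text \<open>Through this identity, \<open>backward_shift_on_entire\<close> says that the shift of
  the Taylor sequence of an entire function again has infinite radius of convergence.\<close>

lemma taylor_coeffs_image_entire: "taylor_coeffs ` entire = {a. conv_radius a = \<infinity>}"
proof (intro equalityI subsetI)
  fix a assume "a \<in> {a :: nat \<Rightarrow> complex. conv_radius a = \<infinity>}"
  then show "a \<in> taylor_coeffs ` entire"
    using taylor_coeffs_power_series[of a] power_series_entire[of a] by (intro image_eqI[of a _ "power_series a"]) auto
next
  fix a assume "a \<in> taylor_coeffs ` entire"
  then show "a \<in> {a. conv_radius a = \<infinity>}" using conv_radius_taylor_coeffs by auto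
qed

lemma taylor_coeffs_add:
  assumes "f \<in> entire" "g \<in> entire"
  shows "taylor_coeffs (\<lambda>z. f z + g z) n = taylor_coeffs f n + taylor_coeffs g n"
  unfolding taylor_coeffs_def
  by (subst higher_deriv_add[OF entire_holomorphic_on entire_holomorphic_on, OF assms open_UNIV UNIV_I])
    (rule add_divide_distrib)

lemma taylor_coeffs_diff:
  assumes "f \<in> entire" "g \<in> entire"
  shows "taylor_coeffs (\<lambda>z. f z - g z) n = taylor_coeffs f n - taylor_coeffs g n"
  unfolding taylor_coeffs_def
  by (subst higher_deriv_diff[OF entire_holomorphic_on entire_holomorphic_on, OF assms open_UNIV UNIV_I])
    (rule diff_divide_distrib)

lemma taylor_coeffs_cmult:
  assumes "f \<in> entire"
  shows "taylor_coeffs (\<lambda>z. c * f z) n = c * taylor_coeffs f n"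
  unfolding taylor_coeffs_def
  by (subst higher_deriv_cmult[OF entire_holomorphic_on, OF assms UNIV_I open_UNIV]) simp

section \<open>Dense orbits\<close>

lemma topspace_entire_topology [simp]: "topspace entire_topology = entire"
proof -
  \<comment> \<open>The empty compact set imposes no condition, so the whole space is itself a
    generating set.\<close>
  have "entire = {g \<in> entire. \<forall>z\<in>{}. dist (g z) ((\<lambda>z. 0) z) < (1::real)}" by simp
  moreover have "(\<lambda>z. 0) \<in> entire" by (simp add: entire_def)
  ultimately have "entire \<in> {{g \<in> entire. \<forall>z\<in>K. dist (g z) (f z) < e} | f K e.
          f \<in> entire \<and> compact K \<and> e > (0::real)}"
    by (intro CollectI exI[of _ "\<lambda>z. 0"] exI[of _ "{}"] exI[of _ "1::real"] conjI) auto
  then show ?thesis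
    unfolding entire_topology_def topology_generated_by_topspace by blast
qed

text \<open>Induction on the generation of the topology. In the basic case \<open>f\<close> need not
  be the centre \<open>h\<close>, but the continuous function \<open>dist (f z) (h z)\<close>
  attains its maximum on the compact \<open>K\<close>, which leaves a positive margin.\<close>

lemma openin_entire_topology_imp_ball:
  assumes "openin entire_topology U" "f \<in> U"
  shows "\<exists>R>0. \<exists>e>0. {g \<in> entire. \<forall>z\<in>cball 0 R. dist (g z) (f z) < e} \<subseteq> U"
proof -
  have "generate_topology_on {{g \<in> entire. \<forall>z\<in>K. dist (g z) (f z) < e} | f K e.
          f \<in> entire \<and> compact K \<and> e > (0::real)} U"
    using assms(1) unfolding entire_topology_def by (rule openin_topology_generated_by)
  then show ?thesis using assms(2)
  proof (induction)
    case Empty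
    then show ?case by simp
  next
    case (Int U V)
    then have "f \<in> U" "f \<in> V" by auto
    then obtain R e R' e' where *: "R > 0" "e > 0" "R' > 0" "e' > 0"
        "{g \<in> entire. \<forall>z\<in>cball 0 R. dist (g z) (f z) < e} \<subseteq> U"
        "{g \<in> entire. \<forall>z\<in>cball 0 R'. dist (g z) (f z) < e'} \<subseteq> V"
      using Int.IH by blast
    have "{g \<in> entire. \<forall>z\<in>cball 0 (max R R'). dist (g z) (f z) < min e e'} \<subseteq> U \<inter> V"
      using *(5,6) by force
    then show ?case using *(1-4)
      by (intro exI[of _ "max R R'"] conjI exI[of _ "min e e'"]) auto
  next
    case (UN \<U>)
    then obtain V where "V \<in> \<U>" "f \<in> V" by blast
    with UN.IH show ?case by (meson Union_upper order_trans)
  next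
    case (Basis V)
    then obtain h K d where V: "V = {g \<in> entire. \<forall>z\<in>K. dist (g z) (h z) < d}"
      and h: "h \<in> entire" and K: "compact K" and d: "d > 0" by blast
    have f: "f \<in> entire" and fd: "\<And>z. z \<in> K \<Longrightarrow> dist (f z) (h z) < d"
      using Basis.prems V by auto
    obtain R where R: "R > 0" "K \<subseteq> cball 0 R"
      using bounded_subset_ballD[OF compact_imp_bounded[OF K], of 0] ball_subset_cball by blast
    have "\<exists>e>0. \<forall>z\<in>K. dist (f z) (h z) \<le> d - e"
    proof (cases "K = {}")
      case True
      then show ?thesis by (auto intro: exI[of _ 1])
    next
      case False
      have "continuous_on K (\<lambda>z. dist (f z) (h z))"
        using f h by (intro continuous_intros entire_continuous_on)
      from continuous_attains_sup[OF K False this] obtain x where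
        "x \<in> K" "\<And>z. z \<in> K \<Longrightarrow> dist (f z) (h z) \<le> dist (f x) (h x)" by blast
      then show ?thesis using fd[of x] by (intro exI[of _ "d - dist (f x) (h x)"]) auto
    qed
    then obtain e where e: "e > 0" "\<And>z. z \<in> K \<Longrightarrow> dist (f z) (h z) \<le> d - e" by blast
    have "{g \<in> entire. \<forall>z\<in>cball 0 R. dist (g z) (f z) < e} \<subseteq> V"
    proof
      fix g assume g: "g \<in> {g \<in> entire. \<forall>z\<in>cball 0 R. dist (g z) (f z) < e}"
      have "dist (g z) (h z) < d" if z: "z \<in> K" for z
      proof -
        have "dist (g z) (f z) < e" using g z R by blast
        then show ?thesis
          using e(2)[OF z] dist_triangle[of "g z" "h z" "f z"] by linarith
      qed
      then show "g \<in> V" using g V by blast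
    qed
    then show ?case using R e by blast
  qed
qed

lemma HC_I:
  assumes "\<And>n. (T ^^ n) f \<in> entire"
    and "\<And>g R e. g \<in> entire \<Longrightarrow> R > 0 \<Longrightarrow> e > 0 \<Longrightarrow>
      \<exists>n. \<forall>z\<in>cball 0 R. dist ((T ^^ n) f z) (g z) < e"
  shows "f \<in> HC T"
proof -
  have "entire_topology closure_of (range (\<lambda>n. (T ^^ n) f)) = entire"
  proof
    show "entire_topology closure_of (range (\<lambda>n. (T ^^ n) f)) \<subseteq> entire"
      using closure_of_subset_topspace[of entire_topology] by simp
    show "entire \<subseteq> entire_topology closure_of (range (\<lambda>n. (T ^^ n) f))"
    proof
      fix g assume g: "g \<in> entire"
      have "\<exists>h. h \<in> range (\<lambda>n. (T ^^ n) f) \<and> h \<in> U"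
        if "g \<in> U \<and> openin entire_topology U" for U
      proof -
        from that obtain R e where "R > 0" "e > 0"
          and U: "{h \<in> entire. \<forall>z\<in>cball 0 R. dist (h z) (g z) < e} \<subseteq> U"
          using openin_entire_topology_imp_ball by blast
        then obtain n where "\<forall>z\<in>cball 0 R. dist ((T ^^ n) f z) (g z) < e"
          using assms(2) g by blast
        then show ?thesis
          using U assms(1) by blast
      qed
      with g show "g \<in> entire_topology closure_of (range (\<lambda>n. (T ^^ n) f))"
        by (simp add: in_closure_of)
    qed
  qed
  then show ?thesis using assms(1)[of 0] by (simp add: HC_def)
qed

text \<open>An iterate lying in the open set is automatically entire, whereas \<open>HC\<close>
  demands this explicitly only of \<open>f\<close>.\<close>

lemma HC_D:
  assumes "f \<in> HC T" "g \<in> entire" "compact K" "e > 0"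
  shows "\<exists>n. (T ^^ n) f \<in> entire \<and> (\<forall>z\<in>K. dist ((T ^^ n) f z) (g z) < e)"
proof -
  let ?U = "{h \<in> entire. \<forall>z\<in>K. dist (h z) (g z) < e}"
  have U: "openin entire_topology ?U"
    unfolding entire_topology_def by (rule topology_generated_by_Basis) (use assms in blast)
  have "g \<in> ?U" using assms by simp
  have "g \<in> entire_topology closure_of (range (\<lambda>n. (T ^^ n) f))"
    using assms by (simp add: HC_def)
  then have "\<forall>U. g \<in> U \<and> openin entire_topology U \<longrightarrow> (\<exists>h. h \<in> range (\<lambda>n. (T ^^ n) f) \<and> h \<in> U)"
    unfolding in_closure_of by (rule conjunct2)
  then have "\<exists>h. h \<in> range (\<lambda>n. (T ^^ n) f) \<and> h \<in> ?U"
    by (rule allE[of _ ?U]) (use U \<open>g \<in> ?U\<close> in simp)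
  then show ?thesis by blast
qed

section \<open>Coefficient estimates and uniform estimates on disks\<close>

lemma dist_le_of_taylor_coeffs:
  assumes "f \<in> entire" "g \<in> entire"
    and le: "\<And>m. norm (taylor_coeffs f m - taylor_coeffs g m) * R ^ m \<le> e / 2 ^ m"
    and z: "z \<in> cball 0 R"
  shows "dist (f z) (g z) \<le> 2 * e"
proof -
  have s: "(\<lambda>m. (taylor_coeffs f m - taylor_coeffs g m) * z ^ m) sums (f z - g z)"
    using sums_diff[OF taylor_coeffs_sums[OF assms(1), of z] taylor_coeffs_sums[OF assms(2), of z]]
    by (simp add: algebra_simps)
  have g: "(\<lambda>m. e / 2 ^ m) sums (2 * e)"
    using sums_mult[OF geometric_sums[of "1/2 :: real"], of e] by (simp add: power_divide mult.commute)
  have b: "norm ((taylor_coeffs f m - taylor_coeffs g m) * z ^ m) \<le> e / 2 ^ m" for m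
  proof -
    have "norm ((taylor_coeffs f m - taylor_coeffs g m) * z ^ m)
        \<le> norm (taylor_coeffs f m - taylor_coeffs g m) * R ^ m"
      using z by (auto simp: norm_mult norm_power intro!: mult_left_mono power_mono)
    then show ?thesis using le[of m] by linarith
  qed
  have "norm (\<Sum>m. (taylor_coeffs f m - taylor_coeffs g m) * z ^ m) \<le> (\<Sum>m. e / 2 ^ m)"
    by (rule norm_suminf_le) (use b g in \<open>auto simp: sums_iff\<close>)
  then show ?thesis using s g by (simp add: sums_iff dist_norm)
qed

text \<open>Cauchy's inequality on the unit circle, applied to the difference.\<close>

lemma taylor_coeffs_diff_le:
  assumes "f \<in> entire" "g \<in> entire" "\<And>z. z \<in> cball 0 1 \<Longrightarrow> dist (f z) (g z) \<le> e"
  shows "norm (taylor_coeffs f n - taylor_coeffs g n) \<le> e"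
proof -
  have hol: "(\<lambda>z. f z - g z) holomorphic_on A" for A
    using assms by (intro holomorphic_intros entire_holomorphic_on)
  have "norm ((deriv ^^ n) (\<lambda>z. f z - g z) 0) \<le> fact n * e / 1 ^ n"
    by (rule Cauchy_inequality)
      (use assms(3) hol in \<open>auto simp: dist_norm holomorphic_on_imp_continuous_on\<close>)
  then have "norm (taylor_coeffs (\<lambda>z. f z - g z) n) \<le> e"
    by (simp add: taylor_coeffs_def norm_divide field_simps)
  then show ?thesis using assms by (simp add: taylor_coeffs_diff)
qed

section \<open>Growth of the weights\<close>

text \<open>The \<open>v\<^sub>n\<close> of the overview: the \<open>N\<close>-th power of the shift
  multiplies the coefficient at \<open>N + m\<close> by a quotient of two such products and moves it
  to \<open>m\<close>.\<close>

definition weight_prod :: "(nat \<Rightarrow> complex) \<Rightarrow> nat \<Rightarrow> complex" where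
  "weight_prod w n = (\<Prod>k=1..n. w k)"

lemma weight_prod_0 [simp]: "weight_prod w 0 = 1"
  by (simp add: weight_prod_def)

lemma weight_prod_Suc: "weight_prod w (Suc n) = w (Suc n) * weight_prod w n"
  by (simp add: weight_prod_def mult.commute)

lemma weight_prod_nonzero: "weight w \<Longrightarrow> weight_prod w n \<noteq> 0"
  by (simp add: weight_prod_def weight_def)

lemma backward_shift_on_entire_imp_weight: "backward_shift_on_entire w \<Longrightarrow> weight w"
  by (simp add: backward_shift_on_entire_def)

lemma taylor_coeffs_backward_shift:
  assumes "backward_shift_on_entire w" "f \<in> entire"
  shows "backward_shift w f \<in> entire"
    and "taylor_coeffs (backward_shift w f) = seq_shift w (taylor_coeffs f)"
proof -
  have "conv_radius (seq_shift w (taylor_coeffs f)) = \<infinity>"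
    using assms unfolding backward_shift_on_entire_def taylor_coeffs_image_entire by blast
  then show "backward_shift w f \<in> entire"
    and "taylor_coeffs (backward_shift w f) = seq_shift w (taylor_coeffs f)"
    unfolding backward_shift_def by (rule power_series_entire, rule taylor_coeffs_power_series)
qed

lemma backward_shift_funpow:
  assumes w: "backward_shift_on_entire w" and f: "f \<in> entire"
  shows "(backward_shift w ^^ N) f \<in> entire"
    and "taylor_coeffs ((backward_shift w ^^ N) f) m
           = weight_prod w (N + m) / weight_prod w m * taylor_coeffs f (N + m)"
proof -
  have "(backward_shift w ^^ N) f \<in> entire \<and>
      (\<forall>m. taylor_coeffs ((backward_shift w ^^ N) f) m
           = weight_prod w (N + m) / weight_prod w m * taylor_coeffs f (N + m))"
  proof (induction N)
    case 0
    then show ?case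
      using f weight_prod_nonzero[OF backward_shift_on_entire_imp_weight[OF w]] by simp
  next
    case (Suc N)
    have "w (Suc m) \<noteq> 0" for m
      using backward_shift_on_entire_imp_weight[OF w] by (simp add: weight_def)
    with Suc taylor_coeffs_backward_shift[OF w, of "(backward_shift w ^^ N) f"] show ?case
      by (simp add: seq_shift_def weight_prod_Suc)
  qed
  then show "(backward_shift w ^^ N) f \<in> entire"
    and "taylor_coeffs ((backward_shift w ^^ N) f) m
           = weight_prod w (N + m) / weight_prod w m * taylor_coeffs f (N + m)"
    by auto
qed

text \<open>If infinitely many \<open>w n\<close> exceeded \<open>real (Suc k) ^ n\<close> for every
  \<open>k\<close>, reciprocals of weights along a sparse set of indices would form an entire
  function with a non-entire shift. For a suitable \<open>k\<close> the finitely many exceptions are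
  absorbed into \<open>K\<close>.\<close>

lemma weight_exponential_bound:
  assumes w: "backward_shift_on_entire w"
  shows "\<exists>K\<ge>1. \<forall>n. norm (w n) \<le> K ^ n"
proof -
  have "\<exists>k::nat. finite {n. norm (w n) > real (Suc k) ^ n}"
  proof (rule ccontr)
    assume inf: "\<nexists>k. finite {n. norm (w n) > real (Suc k) ^ n}"
    have unbounded: "\<exists>n\<ge>N. norm (w n) > real (Suc k) ^ n" for k N
      using inf infinite_nat_iff_unbounded_le[of "{n. norm (w n) > real (Suc k) ^ n}"] by auto
    have "\<exists>s. \<forall>k. norm (w (s k)) > real (Suc k) ^ s k \<and> s k < s (Suc k)"
    proof (rule dependent_nat_choice)
      show "\<exists>n. norm (w n) > real (Suc 0) ^ n"
        using unbounded[of 0 0] by auto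
      show "\<exists>y. norm (w y) > real (Suc (Suc k)) ^ y \<and> x < y" for x k
        using unbounded[of "Suc x" "Suc k"] by (auto simp: Suc_le_eq)
    qed
    then obtain s where s: "\<And>k. norm (w (s k)) > real (Suc k) ^ s k" and "\<And>k. s k < s (Suc k)"
      by blast
    then have mono: "strict_mono s" by (simp add: strict_mono_Suc_iff)
    \<comment> \<open>\<open>a\<close> is the Taylor sequence of an entire function, but infinitely many terms of its shift
      are \<open>1\<close>.\<close>
    define a where "a n = (if n \<in> range s then inverse (w n) else 0)" for n
    have "conv_radius a = \<infinity>"
    proof (rule conv_radius_infty_if_eventually_le)
      fix r :: real assume r: "r > 0"
      obtain k0 where k0: "r \<le> real k0" using real_arch_simple by blast
      have le1: "norm (a n) * r ^ n \<le> 1" if "n \<ge> s k0" for n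
      proof (cases "n \<in> range s")
        case True
        then obtain k where k: "n = s k" by blast
        with that mono have "k0 \<le> k" by (simp add: strict_mono_less_eq)
        then have "r ^ n \<le> real (Suc k) ^ n" using r k0 by (intro power_mono) auto
        also have "\<dots> \<le> norm (w n)" using s[of k] k by simp
        finally have "inverse (norm (w n)) * r ^ n \<le> inverse (norm (w n)) * norm (w n)"
          by (intro mult_left_mono) auto
        also have "\<dots> \<le> 1" by (cases "w n = 0") auto
        finally show ?thesis using True by (simp add: a_def norm_inverse)
      qed (simp add: a_def)
      then show "\<exists>n0. \<forall>n\<ge>n0. norm (a n) * r ^ n \<le> 1" by blast
    qed
    then have "conv_radius (seq_shift w a) = \<infinity>"
      using w power_series_entire[of a] taylor_coeffs_power_series[of a]
        conv_radius_taylor_coeffs[OF taylor_coeffs_backward_shift(1)[OF w], of "power_series a"]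
        taylor_coeffs_backward_shift(2)[OF w, of "power_series a"] by simp
    then obtain C where C: "\<And>n. norm (seq_shift w a n) * 2 ^ n \<le> C"
      unfolding conv_radius_infty_iff_bounded by (meson zero_less_numeral)
    obtain n0 where n0: "C < 2 ^ n0" using real_arch_pow[of 2 C] by auto
    define n where "n = s (Suc n0) - 1"
    have ge: "s (Suc n0) \<ge> Suc n0" using mono by (rule strict_mono_imp_increasing)
    then have n: "Suc n = s (Suc n0)" "n \<ge> n0" by (auto simp: n_def)
    have "seq_shift w a n = 1"
      using n(1) w by (simp add: seq_shift_def a_def backward_shift_on_entire_def weight_def)
    then have "2 ^ n \<le> C" using C[of n] by simp
    moreover have "(2::real) ^ n0 \<le> 2 ^ n" using n by (intro power_increasing) auto
    ultimately show False using n0 by linarith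
  qed
  then obtain k :: nat where fin: "finite {n. norm (w n) > real (Suc k) ^ n}" by blast
  define A where "A = {n. norm (w n) > real (Suc k) ^ n}"
  define K where "K = Max (insert (real (Suc k)) ((\<lambda>n. norm (w n)) ` A))"
  have finA: "finite (insert (real (Suc k)) ((\<lambda>n. norm (w n)) ` A))"
    using fin by (simp add: A_def)
  have K: "real (Suc k) \<le> K" unfolding K_def by (rule Max_ge[OF finA]) simp
  then have K1: "1 \<le> K" by simp
  have "norm (w n) \<le> K ^ n" for n
  proof (cases "n \<in> A")
    case True
    then have "norm (w n) \<le> K" unfolding K_def by (intro Max_ge[OF finA]) simp
    \<comment> \<open>Since \<open>w 0 = 1\<close> does not exceed the zeroth power, exceptional
      indices are positive, and there \<open>K \<le> K ^ n\<close>.\<close>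
    moreover have "n \<noteq> 0"
      using True backward_shift_on_entire_imp_weight[OF w]
      by (cases n) (auto simp: A_def weight_def)
    then have "K \<le> K ^ n" using self_le_power[OF K1] by simp
    ultimately show ?thesis by linarith
  next
    case False
    then have "norm (w n) \<le> real (Suc k) ^ n" by (simp add: A_def)
    also have "\<dots> \<le> K ^ n" using K by (intro power_mono) auto
    finally show ?thesis .
  qed
  with K1 show ?thesis by blast
qed

text \<open>The quotient is a product of \<open>N\<close> weights with indices at most
  \<open>N + m\<close>, each bounded by \<open>K ^ (N + m)\<close>.\<close>

lemma weight_prod_quotient_bound:
  assumes w: "weight w" and K: "K \<ge> 1" "\<And>n. norm (w n) \<le> K ^ n"
  shows "norm (weight_prod w (N + m) / weight_prod w m) \<le> K ^ (N * (N + m))"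
proof (induction N)
  case 0
  then show ?case using weight_prod_nonzero[OF w] by simp
next
  case (Suc N)
  have "norm (weight_prod w (Suc N + m) / weight_prod w m)
      = norm (w (Suc N + m)) * norm (weight_prod w (N + m) / weight_prod w m)"
    by (simp add: weight_prod_Suc norm_mult norm_divide)
  also have "\<dots> \<le> K ^ (Suc N + m) * K ^ (N * (N + m))"
    by (intro mult_mono Suc K) (use K in auto)
  also have "\<dots> = K ^ (Suc N + m + N * (N + m))" by (simp add: power_add)
  also have "\<dots> \<le> K ^ (Suc N * (Suc N + m))"
    using K by (intro power_increasing) (auto simp: algebra_simps)
  finally show ?case .
qed

text \<open>Only windows are asked for, because a dense orbit controls \<open>v\<close> near its
  return times and not at every index.\<close>

definition superexponential_windows :: "(nat \<Rightarrow> complex) \<Rightarrow> bool" where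
  "superexponential_windows v \<longleftrightarrow>
     (\<forall>Q>0. \<forall>M N0. \<exists>N\<ge>N0. \<forall>m<M. Q ^ (N + m) \<le> norm (v (N + m)))"

text \<open>An orbit element close to a polynomial with coefficients \<open>2 * R\<close> has
  initial coefficients of modulus at least \<open>R\<close>. These are
  \<open>v (N + m) / v m\<close> times coefficients of \<open>f\<close> bounded by
  \<open>C / Q ^ (N + m)\<close>, which forces \<open>v (N + m)\<close> to be large.\<close>

lemma hypercyclic_imp_superexponential_windows:
  assumes w: "backward_shift_on_entire w" and f: "f \<in> HC (backward_shift w)"
  shows "superexponential_windows (weight_prod w)"
  unfolding superexponential_windows_def
proof (intro allI impI)
  fix Q :: real and M N0 :: nat assume Q: "Q > 0"
  let ?v = "weight_prod w" and ?\<alpha> = "taylor_coeffs f"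
  have f_entire: "f \<in> entire" using f by (simp add: HC_def)
  have v: "?v n \<noteq> 0" for n
    using w by (simp add: weight_prod_nonzero backward_shift_on_entire_imp_weight)
  obtain C where C: "\<And>n. norm (?\<alpha> n) * Q ^ n \<le> C"
    using conv_radius_taylor_coeffs[OF f_entire] Q unfolding conv_radius_infty_iff_bounded by blast
  \<comment> \<open>The first sum excludes return times \<open>N < N0\<close>, the second dominates
    each \<open>\<bar>C\<bar> / norm (v m)\<close>, and the 1 makes the comparison strict.\<close>
  define R where "R = 1 + (\<Sum>n<N0. norm (?v n * ?\<alpha> n)) + (\<Sum>m<Suc M. \<bar>C\<bar> / norm (?v m))"
  have sums_nonneg: "0 \<le> (\<Sum>n<N0. norm (?v n * ?\<alpha> n))" "0 \<le> (\<Sum>m<Suc M. \<bar>C\<bar> / norm (?v m))"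
    by (intro sum_nonneg; simp)+
  then have R: "R > 0" unfolding R_def by linarith
  \<comment> \<open>With \<open>Suc M\<close> coefficients, \<open>m = 0\<close> is available even
    for \<open>M = 0\<close>; it is the coefficient that rules out \<open>N < N0\<close>.\<close>
  define g where "g = power_series (\<lambda>m. if m < Suc M then of_real (2 * R) else 0)"
  have cr: "conv_radius (\<lambda>m. if m < Suc M then of_real (2 * R) else (0::complex)) = \<infinity>"
  proof (rule conv_radius_inftyI'')
    show "summable (\<lambda>n. (if n < Suc M then of_real (2 * R) else 0) * z ^ n)" for z :: complex
      by (rule summable_finite[of "{..<Suc M}"]) auto
  qed
  have g: "g \<in> entire" "taylor_coeffs g = (\<lambda>m. if m < Suc M then of_real (2 * R) else 0)"
    unfolding g_def using cr by (rule power_series_entire, rule taylor_coeffs_power_series)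
  obtain N where N: "(backward_shift w ^^ N) f \<in> entire"
      "\<And>z. z \<in> cball 0 1 \<Longrightarrow> dist ((backward_shift w ^^ N) f z) (g z) < R"
    using HC_D[OF f g(1) compact_cball R, of 0 1] by blast
  have big: "R \<le> norm (?v (N + m) / ?v m * ?\<alpha> (N + m))" if "m < Suc M" for m
  proof -
    have "norm (taylor_coeffs ((backward_shift w ^^ N) f) m - taylor_coeffs g m) \<le> R"
      by (rule taylor_coeffs_diff_le[OF N(1) g(1)]) (use N(2) in force)
    then have "norm (?v (N + m) / ?v m * ?\<alpha> (N + m) - of_real (2 * R)) \<le> R"
      using that by (simp add: g(2) backward_shift_funpow(2)[OF w f_entire])
    moreover have "norm (of_real (2 * R) :: complex) = 2 * R" using R by (simp only: norm_of_real)
    ultimately show ?thesis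
      using norm_triangle_ineq2[of "of_real (2 * R) :: complex" "?v (N + m) / ?v m * ?\<alpha> (N + m)"]
      by (simp add: norm_minus_commute)
  qed
  have "N \<ge> N0"
  proof (rule ccontr)
    assume "\<not> N \<ge> N0"
    then have "norm (?v N * ?\<alpha> N) \<le> (\<Sum>n<N0. norm (?v n * ?\<alpha> n))"
      by (intro member_le_sum) auto
    also have "\<dots> < R" using sums_nonneg by (simp add: R_def)
    finally show False using big[of 0] by simp
  qed
  moreover have "Q ^ (N + m) \<le> norm (?v (N + m))" if "m < M" for m
  proof -
    have "\<bar>C\<bar> / norm (?v m) \<le> (\<Sum>m<Suc M. \<bar>C\<bar> / norm (?v m))"
      using that by (intro member_le_sum) auto
    then have "\<bar>C\<bar> / norm (?v m) \<le> R" using sums_nonneg by (simp add: R_def)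
    with big[of m] that have "\<bar>C\<bar> / norm (?v m) \<le> norm (?v (N + m) / ?v m * ?\<alpha> (N + m))" by simp
    then have "\<bar>C\<bar> \<le> norm (?v (N + m)) * norm (?\<alpha> (N + m))"
      using v[of m] by (simp add: norm_mult norm_divide field_simps)
    then have "norm (?\<alpha> (N + m)) * Q ^ (N + m) \<le> norm (?\<alpha> (N + m)) * norm (?v (N + m))"
      using C[of "N + m"] by (simp add: mult.commute)
    moreover have "?\<alpha> (N + m) \<noteq> 0" using big[of m] that R by auto
    ultimately show ?thesis by simp
  qed
  ultimately show "\<exists>N\<ge>N0. \<forall>m<M. Q ^ (N + m) \<le> norm (?v (N + m))" by blast
qed

section \<open>Construction of the universal sequence\<close>

text \<open>\<open>own n\<close> is the label of the window containing \<open>n\<close>; the second conjunct, with \<open>b\<close> itself in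
  place of a power, suffices for the tail because every polynomial vanishing at \<open>0\<close> is
  \<open>O(\<bar>x\<bar>)\<close> near \<open>0\<close>.\<close>

definition universal_sequence ::
    "(nat \<Rightarrow> complex) \<Rightarrow> complex set \<Rightarrow> (nat \<Rightarrow> complex) \<Rightarrow> (nat \<Rightarrow> nat) \<Rightarrow> bool" where
  "universal_sequence v D b own \<longleftrightarrow> conv_radius b = \<infinity> \<and>
    (\<forall>i l ys q \<epsilon>. l > 0 \<and> ys \<in> lists D \<and> q > 0 \<and> \<epsilon> > 0 \<longrightarrow>
      (\<exists>N. (\<forall>m<length ys. own (N + m) = i \<and> norm (b (N + m)) < \<epsilon> \<and>
                v (N + m) / v m * b (N + m) ^ l = ys ! m) \<and>
           (\<forall>m\<ge>length ys. norm (v (N + m) / v m * b (N + m)) * q ^ m \<le> \<epsilon> / 2 ^ m)))"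

text \<open>Windows are chosen recursively, each so far out that \<open>b\<close> on it is tiny
  compared with the possible growth of \<open>v (N + m) / v m\<close> from all earlier starts
  \<open>N\<close>. Every task recurs infinitely often, so it can be met at a window late enough for
  the given \<open>q\<close> and \<open>\<epsilon>\<close>.\<close>

lemma universal_sequence_exists:
  fixes v :: "nat \<Rightarrow> complex" and D :: "complex set"
  assumes v: "\<And>n. v n \<noteq> 0"
    and K: "K \<ge> 1" "\<And>N m. norm (v (N + m) / v m) \<le> K ^ (N * (N + m))"
    and windows: "superexponential_windows v"
    and D: "countable D" "D \<noteq> {}"
  shows "\<exists>b own. universal_sequence v D b own"
proof -
  \<comment> \<open>A task consists of a label, a positive exponent and a list of targets.\<close>
  define T :: "(nat \<times> nat \<times> complex list) set" where "T = UNIV \<times> {0<..} \<times> lists D"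
  have T: "countable T" "T \<noteq> {}"
    using D by (auto simp: T_def)
  \<comment> \<open>The second component of the decoded pair is a dummy that makes each task recur
    at arbitrarily large \<open>j\<close>.\<close>
  define e where "e j = from_nat_into T (fst (prod_decode j))" for j
  have e_T: "e j \<in> T" for j
    unfolding e_def using T(2) by (rule from_nat_into)
  have e_onto: "\<exists>j\<ge>k. e j = t" if "t \<in> T" for t k
  proof -
    obtain a where "from_nat_into T a = t"
      using from_nat_into_surj[OF T(1) \<open>t \<in> T\<close>] by blast
    then show ?thesis
      by (intro exI[of _ "prod_encode (a, k)"]) (simp add: e_def le_prod_encode_2)
  qed
  define idx where "idx j = fst (e j)" for j
  define l where "l j = fst (snd (e j))" for j
  define ys where "ys j = snd (snd (e j))" for j
  have l: "l j > 0" for j using e_T[of j] by (auto simp: l_def T_def)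
  \<comment> \<open>With \<open>n\<close> a window start, \<open>K ^ n\<close> cancels the quotient
    bound, \<open>real j + 1\<close> eventually dominates any \<open>q\<close>, and 2 leaves a
    geometric factor.\<close>
  define R where "R j n = 2 * (real j + 1) * K ^ n" for j n
  have R_pos: "R j n > 0" for j n using K by (simp add: R_def)
  have R_mono: "R i m \<le> R j n" if "i \<le> j" "m \<le> n" for i j m n
    unfolding R_def using that K by (intro mult_mono power_increasing) auto
  have R_ge: "2 * (real j + 1) \<le> R j n" for j n
    using mult_left_mono[OF one_le_power[OF K(1), of n], of "2 * (real j + 1)"] by (simp add: R_def)
  \<comment> \<open>The first condition keeps windows disjoint; the second will make
    \<open>b\<close> small on window \<open>Suc j\<close> relative to the start of window
    \<open>j\<close>. Both relate consecutive windows only, so a single start satisfies just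
    \<open>True\<close>, and window 0 gets no smallness bound.\<close>
  have "\<exists>N. \<forall>j. True \<and> N j + length (ys j) < N (Suc j) \<and>
      (\<forall>m<length (ys (Suc j)). norm (v m * ys (Suc j) ! m) * (R j (N j) ^ l (Suc j)) ^ (N (Suc j) + m)
         \<le> norm (v (N (Suc j) + m)))"
  proof (rule dependent_nat_choice)
    fix N j
    \<comment> \<open>As \<open>B \<ge> 1\<close> and the exponent is positive, the constants coming
      from the targets are absorbed into the exponential rate.\<close>
    define B where "B = 1 + (\<Sum>m<length (ys (Suc j)). norm (v m * ys (Suc j) ! m))"
    have B: "1 \<le> B" unfolding B_def by (simp add: sum_nonneg)
    have "0 < R j N ^ l (Suc j) * B" using B R_pos[of j N] by simp
    then obtain N' where N': "Suc (N + length (ys j)) \<le> N'"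
      "\<And>m. m < length (ys (Suc j)) \<Longrightarrow> (R j N ^ l (Suc j) * B) ^ (N' + m) \<le> norm (v (N' + m))"
      using windows unfolding superexponential_windows_def by blast
    have "norm (v m * ys (Suc j) ! m) * (R j N ^ l (Suc j)) ^ (N' + m) \<le> norm (v (N' + m))"
      if m: "m < length (ys (Suc j))" for m
    proof -
      have "norm (v m * ys (Suc j) ! m) \<le> (\<Sum>m<length (ys (Suc j)). norm (v m * ys (Suc j) ! m))"
        using m by (intro member_le_sum) auto
      also have "\<dots> \<le> B" by (simp add: B_def)
      also have "B \<le> B ^ (N' + m)" using B N'(1) by (intro self_le_power) auto
      finally have "norm (v m * ys (Suc j) ! m) * (R j N ^ l (Suc j)) ^ (N' + m)
          \<le> B ^ (N' + m) * (R j N ^ l (Suc j)) ^ (N' + m)"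
        using R_pos[of j N] by (intro mult_right_mono) auto
      also have "\<dots> \<le> norm (v (N' + m))"
        using N'(2)[OF m] by (simp add: power_mult_distrib mult.commute)
      finally show ?thesis .
    qed
    with N'(1) show "\<exists>N'. True \<and> N + length (ys j) < N' \<and>
      (\<forall>m<length (ys (Suc j)). norm (v m * ys (Suc j) ! m) * (R j N ^ l (Suc j)) ^ (N' + m)
         \<le> norm (v (N' + m)))"
      by (intro exI[of _ N']) auto
  qed simp
  then obtain N where N: "\<And>j. N j + length (ys j) < N (Suc j)"
    and N_small: "\<And>j m. m < length (ys (Suc j)) \<Longrightarrow>
      norm (v m * ys (Suc j) ! m) * (R j (N j) ^ l (Suc j)) ^ (N (Suc j) + m)
         \<le> norm (v (N (Suc j) + m))"
    by blast
  have "N j < N (Suc j)" for j using N[of j] by linarith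
  then have N_mono: "strict_mono N" by (simp add: strict_mono_Suc_iff)
  have N_ge: "j \<le> N j" for j using N_mono by (rule strict_mono_imp_increasing)
  \<comment> \<open>From \<open>N 0\<close> on, this is the last window starting at or before
    \<open>n\<close>; below \<open>N 0\<close> it is 0, so the definition of \<open>b\<close> must
    also test \<open>N (J n) \<le> n\<close>.\<close>
  define J where "J n = (LEAST j. n < N (Suc j))" for n
  have J: "J n = j" if "N j \<le> n" "n < N (Suc j)" for n j
    unfolding J_def
  proof (rule Least_equality)
    fix i assume "n < N (Suc i)"
    with that(1) have "N j < N (Suc i)" by simp
    then show "j \<le> i" using N_mono by (simp add: strict_mono_less)
  qed (rule that(2))
  have n_less: "n < N (Suc (J n))" for n
    unfolding J_def
    by (rule LeastI[of _ n]) (use N_ge[of "Suc n"] in simp)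
  define b where "b n = (if N (J n) \<le> n \<and> n < N (J n) + length (ys (J n))
      then SOME x. x ^ l (J n) = v (n - N (J n)) * ys (J n) ! (n - N (J n)) / v n else 0)" for n
  have b_block: "J (N j + m) = j" "b (N j + m) ^ l j = v m * ys j ! m / v (N j + m)"
    if m: "m < length (ys j)" for j m
  proof -
    show Jj: "J (N j + m) = j" using m N[of j] by (intro J) auto
    have "\<exists>x. x ^ l j = v m * ys j ! m / v (N j + m)"
      using l[of j] exists_complex_root[of "l j" "v m * ys j ! m / v (N j + m)"] by (metis less_numeral_extra(3))
    then show "b (N j + m) ^ l j = v m * ys j ! m / v (N j + m)"
      using someI_ex[of "\<lambda>x. x ^ l j = v m * ys j ! m / v (N j + m)"] m
      by (simp add: b_def Jj)
  qed
  \<comment> \<open>Beyond the start of window \<open>Suc j\<close>, a nonzero value lies in a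
    window \<open>Suc k\<close> with \<open>j \<le> k\<close>, chosen against
    \<open>R k (N k)\<close>, which dominates \<open>R j (N j)\<close>.\<close>
  have b_small: "norm (b n) * R j (N j) ^ n \<le> 1" if n: "N (Suc j) \<le> n" for j n
  proof (cases "N (J n) \<le> n \<and> n < N (J n) + length (ys (J n))")
    case True
    have "N (Suc j) < N (Suc (J n))" using n n_less[of n] by linarith
    then obtain k where k: "J n = Suc k" "j \<le> k"
      using N_mono by (metis Suc_le_D Suc_le_mono less_Suc_eq_le strict_mono_less)
    obtain m where m: "n = N (Suc k) + m" using True k by (metis le_Suc_ex)
    with True k have ml: "m < length (ys (Suc k))" by simp
    \<comment> \<open>Raising to the exponent of the window replaces the chosen root by its
      prescribed power.\<close>
    have "(norm (b n) * R k (N k) ^ n) ^ l (Suc k)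
        = norm (b n ^ l (Suc k)) * (R k (N k) ^ l (Suc k)) ^ n"
      by (simp add: power_mult_distrib norm_power mult.commute flip: power_mult)
    also have "\<dots> = norm (v m * ys (Suc k) ! m) * (R k (N k) ^ l (Suc k)) ^ n / norm (v n)"
      using b_block(2)[OF ml] by (simp add: m norm_divide)
    also have "\<dots> \<le> 1"
      using N_small[OF ml] v[of n] by (simp add: m)
    finally have "(norm (b n) * R k (N k) ^ n) ^ l (Suc k) \<le> 1" .
    then have "norm (b n) * R k (N k) ^ n \<le> 1"
      using l[of "Suc k"] R_pos[of k "N k"] by (simp add: power_le_one_iff)
    moreover have "R j (N j) \<le> R k (N k)"
      using k N_mono by (intro R_mono) (auto simp: strict_mono_less_eq)
    then have "norm (b n) * R j (N j) ^ n \<le> norm (b n) * R k (N k) ^ n"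
      using R_pos[of j "N j"] by (intro mult_left_mono power_mono) auto
    ultimately show ?thesis by linarith
  next
    case False
    then have "b n = 0" unfolding b_def by (rule if_not_P)
    then show ?thesis by simp
  qed
  have "conv_radius b = \<infinity>"
  proof (rule conv_radius_infty_if_eventually_le)
    fix r :: real assume r: "r > 0"
    obtain j where "r \<le> real j" using real_arch_simple by blast
    then have "r \<le> 2 * (real j + 1)" by simp
    then have "r \<le> R j (N j)" using R_ge by (rule order_trans)
    then have "norm (b n) * r ^ n \<le> norm (b n) * R j (N j) ^ n" for n
      using r by (intro mult_left_mono power_mono) auto
    with b_small[of j] show "\<exists>n0. \<forall>n\<ge>n0. norm (b n) * r ^ n \<le> 1"
      by (meson order_trans)
  qed
  moreover
  have "\<exists>N. (\<forall>m<length y. idx (J (N + m)) = i \<and> norm (b (N + m)) < \<epsilon> \<and>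
                v (N + m) / v m * b (N + m) ^ d = y ! m) \<and>
           (\<forall>m\<ge>length y. norm (v (N + m) / v m * b (N + m)) * q ^ m \<le> \<epsilon> / 2 ^ m)"
    if "d > 0" "y \<in> lists D" "q > 0" "\<epsilon> > 0" for i d y and q \<epsilon> :: real
  proof -
    obtain k1 where k1: "q \<le> real k1" using real_arch_simple by blast
    obtain k2 where k2: "(1/2) ^ k2 < \<epsilon>" using real_arch_pow_inv[OF \<open>\<epsilon> > 0\<close>, of "1/2"] by auto
    have "(i, d, y) \<in> T" using that by (auto simp: T_def)
    \<comment> \<open>\<open>Suc\<close> makes \<open>j\<close> positive, so window \<open>j\<close>
      has a predecessor against which its values were made small.\<close>
    then obtain j where j: "Suc (max k1 k2) \<le> j" "e j = (i, d, y)" using e_onto by blast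
    then have t: "idx j = i" "l j = d" "ys j = y" by (auto simp: idx_def l_def ys_def)
    have half: "(1/2) ^ n < \<epsilon>" if "j \<le> n" for n
    proof -
      have "(1/2 :: real) ^ n \<le> (1/2) ^ k2" using j that by (intro power_decreasing) auto
      with k2 show ?thesis by linarith
    qed
    show ?thesis
    proof (intro exI[of _ "N j"] conjI allI impI)
      fix m assume m: "m < length y"
      then have m': "m < length (ys j)" by (simp add: t)
      show "idx (J (N j + m)) = i" using b_block(1)[OF m'] t by simp
      show "v (N j + m) / v m * b (N j + m) ^ d = y ! m"
        using b_block(2)[OF m'] v by (simp add: t)
      obtain j' where j': "j = Suc j'" using j by (metis Suc_le_D)
      let ?n = "N j + m"
      have "2 \<le> R j' (N j')"
        by (rule order_trans[OF _ R_ge]) simp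
      then have "norm (b ?n) * 2 ^ ?n \<le> norm (b ?n) * R j' (N j') ^ ?n"
        by (intro mult_left_mono power_mono) auto
      also have "\<dots> \<le> 1" by (rule b_small) (simp add: j')
      finally have "norm (b ?n) \<le> (1/2) ^ ?n" by (simp add: power_divide field_simps)
      also have "\<dots> < \<epsilon>" using N_ge[of j] by (intro half) auto
      finally show "norm (b ?n) < \<epsilon>" .
    next
      fix m assume m: "length y \<le> m"
      let ?n = "N j + m"
      show "norm (v ?n / v m * b ?n) * q ^ m \<le> \<epsilon> / 2 ^ m"
      \<comment> \<open>Either \<open>?n\<close> lies in the gap after window \<open>j\<close>,
        where \<open>b\<close> vanishes, or it is late enough for \<open>b_small\<close>.\<close>
      proof (cases "?n < N (Suc j)")
        case True
        then have "J ?n = j" by (intro J) auto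
        then have "b ?n = 0" using m by (simp add: b_def t)
        then show ?thesis using \<open>\<epsilon> > 0\<close> by simp
      next
        case False
        have "q ^ m \<le> (real j + 1) ^ m" using k1 j \<open>q > 0\<close> by (intro power_mono) auto
        also have "\<dots> \<le> (real j + 1) ^ ?n" by (intro power_increasing) auto
        finally have q: "q ^ m \<le> (real j + 1) ^ ?n" .
        have "norm (v ?n / v m * b ?n) * q ^ m = norm (v ?n / v m) * norm (b ?n) * q ^ m"
          by (simp only: norm_mult)
        also have "\<dots> \<le> K ^ (N j * ?n) * norm (b ?n) * (real j + 1) ^ ?n"
          using K q \<open>q > 0\<close> by (intro mult_mono) auto
        also have "\<dots> = (norm (b ?n) * R j (N j) ^ ?n) * (1/2) ^ ?n"
          unfolding R_def power_mult_distrib power_divide power_mult by simp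
        also have "\<dots> \<le> 1 * (1/2) ^ ?n"
          using False by (intro mult_right_mono b_small) auto
        also have "\<dots> = (1/2) ^ N j * (1/2) ^ m" by (simp add: power_add)
        also have "\<dots> \<le> \<epsilon> * (1/2) ^ m"
          using half[OF N_ge[of j]] by (intro mult_right_mono) auto
        finally show ?thesis by (simp add: power_divide)
      qed
    qed
  qed
  ultimately have "universal_sequence v D b (\<lambda>n. idx (J n))"
    unfolding universal_sequence_def by blast
  then show ?thesis by blast
qed

section \<open>The generated algebra\<close>

text \<open>The coefficients of \<open>\<Sum>\<^sub>i P\<^sub>i(f\<^sub>i)\<close>: at
  \<open>n\<close> only the function labelled \<open>own n\<close> can be nonzero, and the other
  polynomials contribute \<open>P\<^sub>i(0) = 0\<close>.\<close>

definition block_poly ::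
    "(nat \<Rightarrow> complex) \<Rightarrow> (nat \<Rightarrow> nat) \<Rightarrow> (nat \<Rightarrow> complex poly) \<Rightarrow> nat \<Rightarrow> complex" where
  "block_poly b own P n = poly (P (own n)) (b n)"

text \<open>The set \<open>I\<close> records which labels may occur: all of them for the full
  algebra, finitely many for the subalgebra that contains a finite set of generators.\<close>

definition admissible :: "nat set \<Rightarrow> (nat \<Rightarrow> complex poly) \<Rightarrow> bool" where
  "admissible I P \<longleftrightarrow> finite {i. P i \<noteq> 0} \<and> {i. P i \<noteq> 0} \<subseteq> I \<and> (\<forall>i. poly (P i) 0 = 0)"

definition block_algebra ::
    "(nat \<Rightarrow> complex) \<Rightarrow> (nat \<Rightarrow> nat) \<Rightarrow> nat set \<Rightarrow> (complex \<Rightarrow> complex) set" where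
  "block_algebra b own I = {power_series (block_poly b own P) | P. admissible I P}"

text \<open>The polynomial is \<open>z\<close> times another one, which is bounded on the
  disk.\<close>

lemma poly_le_norm_if_root_0:
  fixes p :: "complex poly"
  assumes "poly p 0 = 0"
  shows "\<exists>C\<ge>0. \<forall>z. norm z \<le> r \<longrightarrow> norm (poly p z) \<le> C * norm z"
proof -
  obtain s where s: "p = pCons 0 s" using assms by (cases p) auto
  obtain C where C: "C > 0" "\<And>z. norm z \<le> r \<Longrightarrow> norm (poly s z) \<le> C"
    using poly_bound_exists[of r s] by blast
  have "norm (poly p z) \<le> C * norm z" if "norm z \<le> r" for z
    using mult_right_mono[OF C(2)[OF that], of "norm z"] by (simp add: s norm_mult mult.commute)
  then show ?thesis using C(1) by (intro exI[of _ C]) auto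
qed

text \<open>As \<open>b\<close> is bounded and only finitely many polynomials are nonzero, the sum
  of their linear bounds serves for all labels; adding 1 keeps the constant positive for later
  division.\<close>

lemma block_poly_bound:
  assumes b: "conv_radius b = \<infinity>" and P: "admissible I P"
  shows "\<exists>C>0. \<forall>n. norm (block_poly b own P n) \<le> C * norm (b n)"
proof -
  have "\<exists>B. \<forall>n. norm (b n) * 1 ^ n \<le> B"
    using b unfolding conv_radius_infty_iff_bounded by (meson zero_less_one)
  then obtain B where B: "\<And>n. norm (b n) \<le> B" by auto
  have "\<forall>i. \<exists>C\<ge>0. \<forall>z. norm z \<le> B \<longrightarrow> norm (poly (P i) z) \<le> C * norm z"
    using P by (intro allI poly_le_norm_if_root_0) (simp add: admissible_def)
  then obtain C where C: "\<And>i. C i \<ge> 0"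
      "\<And>i z. norm z \<le> B \<Longrightarrow> norm (poly (P i) z) \<le> C i * norm z"
    by metis
  let ?S = "{i. P i \<noteq> 0}"
  have fin: "finite ?S" using P by (simp add: admissible_def)
  have "norm (block_poly b own P n) \<le> (1 + sum C ?S) * norm (b n)" for n
  proof (cases "P (own n) = 0")
    case True
    then show ?thesis using C(1) by (simp add: block_poly_def sum_nonneg)
  next
    case False
    have "norm (block_poly b own P n) \<le> C (own n) * norm (b n)"
      unfolding block_poly_def by (rule C(2)[OF B])
    also have "C (own n) \<le> sum C ?S"
      using False fin C(1) by (intro member_le_sum) auto
    then have "C (own n) * norm (b n) \<le> (1 + sum C ?S) * norm (b n)"
      by (intro mult_right_mono) auto
    finally show ?thesis .
  qed
  moreover have "0 < 1 + sum C ?S" using C(1) by (simp add: add_pos_nonneg sum_nonneg)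
  ultimately show ?thesis by blast
qed

lemma conv_radius_block_poly:
  assumes "conv_radius b = \<infinity>" "admissible I P"
  shows "conv_radius (block_poly b own P) = \<infinity>"
  using block_poly_bound[OF assms, of own] by (auto intro: conv_radius_infty_comparison[OF assms(1)])

lemma block_algebra_memI:
  assumes "admissible I P" "f \<in> entire" "\<And>n. taylor_coeffs f n = block_poly b own P n"
  shows "f \<in> block_algebra b own I"
proof -
  have "f = power_series (block_poly b own P)"
    using power_series_taylor_coeffs[OF assms(2)] assms(3) by (metis ext)
  then show ?thesis unfolding block_algebra_def using assms(1) by blast
qed

lemma block_algebra_memE:
  assumes "f \<in> block_algebra b own I" "conv_radius b = \<infinity>"
  obtains P where "admissible I P" "f = power_series (block_poly b own P)" "f \<in> entire"
    "taylor_coeffs f = block_poly b own P"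
proof -
  obtain P where P: "admissible I P" "f = power_series (block_poly b own P)"
    using assms(1) unfolding block_algebra_def by blast
  with conv_radius_block_poly[OF assms(2) P(1)] show thesis
    using that power_series_entire taylor_coeffs_power_series by blast
qed

text \<open>All operations act label by label on the polynomials, because the Hadamard product
  multiplies coefficients.\<close>

lemma subalgebra_block_algebra:
  assumes b: "conv_radius b = \<infinity>"
  shows "subalgebra (block_algebra b own I)"
proof -
  let ?A = "block_algebra b own I"
  have sub: "?A \<subseteq> entire"
    using b by (auto elim: block_algebra_memE)
  have "admissible I (\<lambda>i. 0)" by (simp add: admissible_def)
  then have "power_series (block_poly b own (\<lambda>i. 0)) \<in> ?A" unfolding block_algebra_def by blast
  moreover have "power_series (block_poly b own (\<lambda>i. 0)) = (\<lambda>z. 0)"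
    by (simp add: block_poly_def power_series_def fun_eq_iff)
  ultimately have zero: "(\<lambda>z. 0) \<in> ?A" by simp
  have add: "(\<lambda>z. f z + g z) \<in> ?A" and mult: "hadamard f g \<in> ?A" if fg: "f \<in> ?A" "g \<in> ?A" for f g
  proof -
    obtain P where P: "admissible I P" "f \<in> entire" "taylor_coeffs f = block_poly b own P"
      using fg(1) b by (rule block_algebra_memE)
    obtain Q where Q: "admissible I Q" "g \<in> entire" "taylor_coeffs g = block_poly b own Q"
      using fg(2) b by (rule block_algebra_memE)
    have fin: "finite ({i. P i \<noteq> 0} \<union> {i. Q i \<noteq> 0})" "{i. P i \<noteq> 0} \<union> {i. Q i \<noteq> 0} \<subseteq> I"
      using P Q by (auto simp: admissible_def)
    have "{i. P i + Q i \<noteq> 0} \<subseteq> {i. P i \<noteq> 0} \<union> {i. Q i \<noteq> 0}" by auto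
    from finite_subset[OF this fin(1)] order_trans[OF this fin(2)]
    have "admissible I (\<lambda>i. P i + Q i)" using P Q by (simp add: admissible_def)
    moreover have "(\<lambda>z. f z + g z) \<in> entire"
      using P(2) Q(2) by (simp add: entire_def holomorphic_on_add)
    ultimately show "(\<lambda>z. f z + g z) \<in> ?A"
      by (rule block_algebra_memI)
        (simp add: taylor_coeffs_add P Q block_poly_def)
    have "{i. P i * Q i \<noteq> 0} \<subseteq> {i. P i \<noteq> 0} \<union> {i. Q i \<noteq> 0}" by auto
    from finite_subset[OF this fin(1)] order_trans[OF this fin(2)]
    have "admissible I (\<lambda>i. P i * Q i)" using P Q by (simp add: admissible_def)
    moreover have "hadamard f g = power_series (block_poly b own (\<lambda>i. P i * Q i))"
      by (simp add: hadamard_def P Q block_poly_def[abs_def])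
    ultimately show "hadamard f g \<in> ?A" unfolding block_algebra_def by blast
  qed
  have scale: "(\<lambda>z. c * f z) \<in> ?A" if f: "f \<in> ?A" for c f
  proof -
    obtain P where P: "admissible I P" "f \<in> entire" "taylor_coeffs f = block_poly b own P"
      using f b by (rule block_algebra_memE)
    have "{i. smult c (P i) \<noteq> 0} \<subseteq> {i. P i \<noteq> 0}" by auto
    from finite_subset[OF this] order_trans[OF this]
    have "admissible I (\<lambda>i. smult c (P i))" using P by (simp add: admissible_def)
    moreover have "(\<lambda>z. c * f z) \<in> entire"
      using P(2) by (simp add: entire_def holomorphic_on_mult)
    ultimately show ?thesis
      by (rule block_algebra_memI) (simp add: taylor_coeffs_cmult P block_poly_def)
  qed
  show ?thesis unfolding subalgebra_def using sub zero add mult scale by blast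
qed

text \<open>A finite \<open>S\<close> involves a finite set \<open>I\<close> of labels, so its hull
  stays in the algebra over \<open>I\<close>. For a label \<open>k\<close> outside \<open>I\<close>,
  the restriction of \<open>b\<close> to label \<open>k\<close> is in the full algebra but not in
  this one.\<close>

lemma block_algebra_not_finitely_generated:
  assumes u: "universal_sequence v D b own" and d: "d \<in> D" "d \<noteq> 0" and S: "finite S"
  shows "\<not> generates S (block_algebra b own UNIV)"
proof
  assume "generates S (block_algebra b own UNIV)"
  then have hull: "subalgebra hull S = block_algebra b own UNIV" by (simp add: generates_def)
  have b: "conv_radius b = \<infinity>" using u by (simp add: universal_sequence_def)
  have "\<forall>f\<in>S. \<exists>P. admissible UNIV P \<and> f = power_series (block_poly b own P)"
    using hull_subset[of S subalgebra] hull unfolding block_algebra_def by blast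
  then obtain P where P: "\<And>f. f \<in> S \<Longrightarrow> admissible UNIV (P f)"
      "\<And>f. f \<in> S \<Longrightarrow> f = power_series (block_poly b own (P f))"
    by metis
  define I where "I = (\<Union>f\<in>S. {i. P f i \<noteq> 0})"
  have "finite I" unfolding I_def using S P(1) by (intro finite_UN_I) (auto simp: admissible_def)
  then obtain k where k: "k \<notin> I" using ex_new_if_finite[OF infinite_UNIV_nat] by blast
  have "admissible I (P f)" if "f \<in> S" for f
    using P(1)[OF that] that by (auto simp: admissible_def I_def)
  then have "S \<subseteq> block_algebra b own I" unfolding block_algebra_def using P(2) by blast
  then have le: "block_algebra b own UNIV \<subseteq> block_algebra b own I"
    using hull_minimal[of S _ subalgebra] subalgebra_block_algebra[OF b] hull by metis
  define X where "X i = (if i = k then [:0, 1:] else (0 :: complex poly))" for i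
  have X: "admissible UNIV X" by (auto simp: admissible_def X_def)
  have mem: "power_series (block_poly b own X) \<in> block_algebra b own UNIV"
    using X unfolding block_algebra_def by blast
  obtain Q where Q: "admissible I Q"
      "taylor_coeffs (power_series (block_poly b own X)) = block_poly b own Q"
    using subsetD[OF le mem] b by (rule block_algebra_memE)
  then have eq: "block_poly b own X = block_poly b own Q"
    using taylor_coeffs_power_series[OF conv_radius_block_poly[OF b X]] by metis
  \<comment> \<open>A single nonzero target with exponent 1 exhibits a nonzero value of
    \<open>b\<close> at label \<open>k\<close>.\<close>
  have "[d] \<in> lists D" using d by simp
  then obtain N where N: "\<forall>m<length [d]. own (N + m) = k \<and> norm (b (N + m)) < 1 \<and>
                v (N + m) / v m * b (N + m) ^ 1 = [d] ! m"
    using u unfolding universal_sequence_def by (meson zero_less_one)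
  then have "own N = k" "b N \<noteq> 0" using d by auto
  moreover have "Q k = 0" using Q(1) k by (auto simp: admissible_def)
  ultimately show False using fun_cong[OF eq, of N] by (simp add: block_poly_def X_def)
qed

text \<open>Where \<open>b\<close> is small, the lowest-order term \<open>c x\<^sup>l\<close> of a polynomial governs the block of
  exponent \<open>l\<close>, so this block reproduces \<open>c\<close> times its list of targets.\<close>

lemma block_algebra_hypercyclic:
  assumes w: "backward_shift_on_entire w"
    and u: "universal_sequence (weight_prod w) D b own"
    and D: "\<And>X. open X \<Longrightarrow> X \<noteq> {} \<Longrightarrow> \<exists>d\<in>D. d \<in> X"
    and P: "admissible I P" "P i \<noteq> 0"
  shows "power_series (block_poly b own P) \<in> HC (backward_shift w)"
proof -
  let ?v = "weight_prod w" and ?c = "block_poly b own P"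
  let ?f = "power_series ?c"
  have b: "conv_radius b = \<infinity>" using u by (simp add: universal_sequence_def)
  note cr = conv_radius_block_poly[OF b P(1)]
  have f: "?f \<in> entire" "taylor_coeffs ?f = ?c"
    using cr by (rule power_series_entire, rule taylor_coeffs_power_series)
  \<comment> \<open>Factoring out the zero at 0 gives \<open>x ^ l * poly s x\<close> with
    \<open>poly s 0 \<noteq> 0\<close>; as the polynomial vanishes at 0, \<open>l\<close> is
    positive and thus an available exponent.\<close>
  obtain s where s: "P i = [:- 0, 1:] ^ order 0 (P i) * s" "\<not> [:- 0, 1:] dvd s"
    using order_decomp[OF P(2), of 0] by blast
  define l where "l = order 0 (P i)"
  have "l > 0" using P by (simp add: l_def admissible_def order_gt_0_iff)
  have Pi: "poly (P i) x = x ^ l * poly s x" for x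
    by (subst s(1)) (simp add: l_def)
  define a where "a = poly s 0"
  have a: "a \<noteq> 0" using s(2) by (simp add: a_def poly_eq_0_iff_dvd)
  show ?thesis
  proof (rule HC_I)
    show "(backward_shift w ^^ n) ?f \<in> entire" for n
      by (rule backward_shift_funpow(1)[OF w f(1)])
    fix g and R e :: real assume g: "g \<in> entire" and R: "R > 0" and e: "e > 0"
    \<comment> \<open>Coefficient errors \<open>2 * \<epsilon> / 2 ^ m\<close> sum to
      \<open>4 * \<epsilon>\<close>, half of \<open>e\<close>.\<close>
    define \<epsilon> where "\<epsilon> = e / 8"
    have \<epsilon>: "\<epsilon> > 0" using e by (simp add: \<epsilon>_def)
    let ?\<gamma> = "taylor_coeffs g"
    \<comment> \<open>Convergence at \<open>2 * R\<close> makes the tail of \<open>g\<close> at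
      \<open>R\<close> geometrically small.\<close>
    have "summable (\<lambda>m. ?\<gamma> m * of_real (2 * R) ^ m)"
      by (rule summable_in_conv_radius) (simp add: conv_radius_taylor_coeffs[OF g])
    then have "(\<lambda>m. norm (?\<gamma> m * of_real (2 * R) ^ m)) \<longlonglongrightarrow> 0"
      by (intro tendsto_norm_zero summable_LIMSEQ_zero)
    then have "\<forall>\<^sub>F m in sequentially. norm (?\<gamma> m * of_real (2 * R) ^ m) < \<epsilon>"
      using \<epsilon> by (rule order_tendstoD)
    then obtain L where L: "\<And>m. m \<ge> L \<Longrightarrow> norm (?\<gamma> m * of_real (2 * R) ^ m) < \<epsilon>"
      unfolding eventually_sequentially by blast
    have \<gamma>_tail: "norm (?\<gamma> m) * R ^ m \<le> \<epsilon> / 2 ^ m" if "m \<ge> L" for m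
    proof -
      have "norm (?\<gamma> m) * R ^ m * 2 ^ m < \<epsilon>"
        using L[OF that] R by (simp add: norm_mult norm_power power_mult_distrib mult_ac)
      then show ?thesis by (simp add: field_simps)
    qed
    \<comment> \<open>The block will reproduce \<open>a\<close> times its targets, so these
      approximate the coefficients of \<open>g\<close> divided by \<open>a\<close>.\<close>
    have "\<forall>m. \<exists>d\<in>D. norm (a * d - ?\<gamma> m) * R ^ m \<le> \<epsilon> / 2 ^ m"
    proof
      fix m
      define \<eta> where "\<eta> = \<epsilon> / 2 ^ m / R ^ m / norm a"
      have "\<eta> > 0" using \<epsilon> R a by (simp add: \<eta>_def)
      then obtain d where d: "d \<in> D" "d \<in> ball (?\<gamma> m / a) \<eta>"
        using D[OF open_ball, of "?\<gamma> m / a" \<eta>] by auto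
      have "norm (a * d - ?\<gamma> m) = norm a * norm (d - ?\<gamma> m / a)"
        using a by (simp add: right_diff_distrib flip: norm_mult)
      also have "\<dots> \<le> norm a * \<eta>"
        using d(2) by (intro mult_left_mono) (auto simp: dist_norm norm_minus_commute)
      finally have "norm (a * d - ?\<gamma> m) * R ^ m \<le> norm a * \<eta> * R ^ m"
        using R by (intro mult_right_mono) auto
      also have "\<dots> = \<epsilon> / 2 ^ m" using a R by (simp add: \<eta>_def)
      finally show "\<exists>d\<in>D. norm (a * d - ?\<gamma> m) * R ^ m \<le> \<epsilon> / 2 ^ m" using d(1) by blast
    qed
    then obtain d where d: "\<And>m. d m \<in> D" "\<And>m. norm (a * d m - ?\<gamma> m) * R ^ m \<le> \<epsilon> / 2 ^ m"
      by metis
    \<comment> \<open>\<open>B\<close> dominates each \<open>norm (d m) * R ^ m * 2 ^ m\<close>, so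
      replacing \<open>poly s\<close> by \<open>a\<close> with error \<open>\<epsilon> / B\<close>
      costs at most \<open>\<epsilon> / 2 ^ m\<close>.\<close>
    define B where "B = 1 + (\<Sum>m<L. norm (d m) * R ^ m * 2 ^ m)"
    have B: "B > 0" unfolding B_def using R by (intro add_pos_nonneg sum_nonneg) auto
    have "isCont (poly s) 0" by simp
    then obtain \<delta> where \<delta>: "\<delta> > 0" "\<And>x. norm x < \<delta> \<Longrightarrow> norm (poly s x - a) < \<epsilon> / B"
      using \<epsilon> B unfolding continuous_at_eps_delta a_def
      by (metis diff_zero dist_norm divide_pos_pos)
    obtain C where C: "C > 0" "\<And>n. norm (?c n) \<le> C * norm (b n)"
      using block_poly_bound[OF b P(1)] by blast
    \<comment> \<open>\<open>\<delta>\<close> serves the block itself, \<open>\<epsilon> / C\<close>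
      the tail.\<close>
    define \<epsilon>' where "\<epsilon>' = min \<delta> (\<epsilon> / C)"
    have \<epsilon>': "\<epsilon>' > 0" using \<delta> \<epsilon> C by (simp add: \<epsilon>'_def)
    have "map d [0..<L] \<in> lists D" using d by auto
    with u \<open>l > 0\<close> R \<epsilon>' have "\<exists>N. (\<forall>m<length (map d [0..<L]). own (N + m) = i \<and>
          norm (b (N + m)) < \<epsilon>' \<and> ?v (N + m) / ?v m * b (N + m) ^ l = map d [0..<L] ! m) \<and>
        (\<forall>m\<ge>length (map d [0..<L]).
          norm (?v (N + m) / ?v m * b (N + m)) * R ^ m \<le> \<epsilon>' / 2 ^ m)"
      unfolding universal_sequence_def by blast
    then obtain N where
      N_block: "\<And>m. m < L \<Longrightarrow> own (N + m) = i \<and> norm (b (N + m)) < \<epsilon>' \<and>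
        ?v (N + m) / ?v m * b (N + m) ^ l = d m" and
      N_tail: "\<And>m. m \<ge> L \<Longrightarrow> norm (?v (N + m) / ?v m * b (N + m)) * R ^ m \<le> \<epsilon>' / 2 ^ m"
      by auto
    let ?h = "(backward_shift w ^^ N) ?f"
    have h: "?h \<in> entire" "\<And>m. taylor_coeffs ?h m = ?v (N + m) / ?v m * ?c (N + m)"
      using backward_shift_funpow[OF w f(1), of N] by (simp_all add: f(2))
    have "norm (taylor_coeffs ?h m - ?\<gamma> m) * R ^ m \<le> (2 * \<epsilon>) / 2 ^ m" for m
    proof (cases "m < L")
      case True
      let ?x = "b (N + m)"
      have x: "norm ?x < \<delta>" "own (N + m) = i" "?v (N + m) / ?v m * ?x ^ l = d m"
        using N_block[OF True] by (auto simp: \<epsilon>'_def)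
      have "taylor_coeffs ?h m = (?v (N + m) / ?v m * ?x ^ l) * poly s ?x"
        by (simp only: h(2) block_poly_def x(2) Pi mult.assoc)
      then have "taylor_coeffs ?h m - ?\<gamma> m = d m * (poly s ?x - a) + (a * d m - ?\<gamma> m)"
        unfolding x(3) by (simp add: algebra_simps)
      then have "norm (taylor_coeffs ?h m - ?\<gamma> m)
          \<le> norm (d m) * norm (poly s ?x - a) + norm (a * d m - ?\<gamma> m)"
        by (metis norm_mult norm_triangle_ineq)
      then have "norm (taylor_coeffs ?h m - ?\<gamma> m) * R ^ m
          \<le> norm (d m) * norm (poly s ?x - a) * R ^ m + norm (a * d m - ?\<gamma> m) * R ^ m"
        using R by (simp add: mult_right_mono flip: distrib_right)
      moreover have "norm (d m) * norm (poly s ?x - a) * R ^ m \<le> \<epsilon> / 2 ^ m"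
      proof -
        have "norm (d m) * R ^ m * 2 ^ m \<le> (\<Sum>m<L. norm (d m) * R ^ m * 2 ^ m)"
          using True R by (intro member_le_sum) auto
        then have "norm (d m) * R ^ m * 2 ^ m \<le> B" by (simp add: B_def)
        then have "norm (d m) * R ^ m * 2 ^ m * norm (poly s ?x - a) \<le> B * (\<epsilon> / B)"
          using \<delta>(2)[OF x(1)] B by (intro mult_mono) auto
        also have "\<dots> = \<epsilon>" using B by simp
        finally show ?thesis by (simp add: field_simps)
      qed
      ultimately show ?thesis using d(2)[of m] by simp
    next
      case False
      then have m: "m \<ge> L" by simp
      have "norm (taylor_coeffs ?h m) * R ^ m = norm (?v (N + m) / ?v m) * norm (?c (N + m)) * R ^ m"
        by (simp only: h(2) norm_mult)
      also have "\<dots> \<le> norm (?v (N + m) / ?v m) * (C * norm (b (N + m))) * R ^ m"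
        using R by (intro mult_right_mono mult_left_mono C(2)) auto
      also have "\<dots> = C * (norm (?v (N + m) / ?v m * b (N + m)) * R ^ m)"
        by (simp only: norm_mult mult_ac)
      also have "\<dots> \<le> C * (\<epsilon>' / 2 ^ m)"
        using C(1) by (intro mult_left_mono N_tail m) auto
      also have "\<dots> \<le> \<epsilon> / 2 ^ m"
      proof -
        have "C * \<epsilon>' \<le> C * (\<epsilon> / C)" using C(1) by (intro mult_left_mono) (auto simp: \<epsilon>'_def)
        then show ?thesis using C(1) by (simp add: divide_right_mono)
      qed
      finally have "norm (taylor_coeffs ?h m) * R ^ m \<le> \<epsilon> / 2 ^ m" .
      moreover have "norm (taylor_coeffs ?h m - ?\<gamma> m) * R ^ m
          \<le> norm (taylor_coeffs ?h m) * R ^ m + norm (?\<gamma> m) * R ^ m"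
        using R by (simp add: mult_right_mono norm_triangle_ineq4 flip: distrib_right)
      ultimately show ?thesis using \<gamma>_tail[OF m] by simp
    qed
    then have "dist (?h z) (g z) \<le> 2 * (2 * \<epsilon>)" if "z \<in> cball 0 R" for z
      using that by (rule dist_le_of_taylor_coeffs[OF h(1) g])
    then have "dist (?h z) (g z) < e" if "z \<in> cball 0 R" for z
      using that e by (force simp: \<epsilon>_def)
    then show "\<exists>N. \<forall>z\<in>cball 0 R. dist ((backward_shift w ^^ N) ?f z) (g z) < e" by blast
  qed
qed

text \<open>Assuming growth rather than hypercyclicity lets the result apply directly to
  \<open>D\<close>, whose hypercyclicity then follows.\<close>

lemma algebrable_HC_backward_shift:
  assumes w: "backward_shift_on_entire w" and windows: "superexponential_windows (weight_prod w)"
  shows "algebrable (HC (backward_shift w))"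
proof -
  obtain D :: "complex set" where D: "countable D"
      "\<And>X. open X \<Longrightarrow> X \<noteq> {} \<Longrightarrow> \<exists>d\<in>D. d \<in> X"
    using countable_dense_setE by blast
  have "open (- {0 :: complex})" "- {0 :: complex} \<noteq> {}"
    by (auto intro!: exI[of _ 1])
  from D(2)[OF this] obtain d where d: "d \<in> D" "d \<noteq> 0" by auto
  have wt: "weight w" using w by (rule backward_shift_on_entire_imp_weight)
  obtain K where K: "K \<ge> 1" "\<And>n. norm (w n) \<le> K ^ n" using weight_exponential_bound[OF w] by blast
  have "\<exists>b own. universal_sequence (weight_prod w) D b own"
    by (rule universal_sequence_exists[OF weight_prod_nonzero[OF wt] K(1)
          weight_prod_quotient_bound[OF wt K] windows D(1)]) (use d in auto)
  then obtain b own where u: "universal_sequence (weight_prod w) D b own" by blast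
  let ?A = "block_algebra b own UNIV"
  have b: "conv_radius b = \<infinity>" using u by (simp add: universal_sequence_def)
  have sub: "subalgebra ?A" using b by (rule subalgebra_block_algebra)
  have "?A \<subseteq> HC (backward_shift w) \<union> {\<lambda>z. 0}"
  proof
    fix f assume "f \<in> ?A"
    then obtain P where P: "admissible UNIV P" "f = power_series (block_poly b own P)"
      unfolding block_algebra_def by blast
    show "f \<in> HC (backward_shift w) \<union> {\<lambda>z. 0}"
    proof (cases "\<exists>i. P i \<noteq> 0")
      case True
      then show ?thesis using block_algebra_hypercyclic[OF w u D(2) P(1)] P(2) by blast
    next
      case False
      then show ?thesis by (simp add: P(2) block_poly_def power_series_def fun_eq_iff)
    qed
  qed
  moreover have no_fin: "\<not> generates S ?A" if "finite S" for S
    using u d that by (rule block_algebra_not_finitely_generated)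
  \<comment> \<open>The algebra is its own generating set, and it is infinite since otherwise it
    would be finitely generated.\<close>
  moreover have gen: "generates ?A ?A"
    using sub unfolding generates_def by (auto simp: hull_same subalgebra_def)
  moreover have "infinite ?A" using gen no_fin by blast
  ultimately show ?thesis unfolding algebrable_def using sub by blast
qed

text \<open>An algebra inside \<open>{\<lambda>z. 0}\<close> is finite and generates itself.\<close>

lemma algebrable_imp_nonempty:
  assumes "algebrable M"
  shows "M \<noteq> {}"
proof
  assume "M = {}"
  then obtain A where A: "subalgebra A" "A \<subseteq> {\<lambda>z. 0}" "\<nexists>S. finite S \<and> generates S A"
    using assms unfolding algebrable_def by auto
  have "generates A A"
    using A(1) unfolding generates_def by (auto simp: hull_same subalgebra_def)
  with A(2,3) show False by (meson finite.emptyI finite.insertI finite_subset)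
qed

section \<open>The MacLane operator\<close>

lemma taylor_coeffs_deriv:
  "taylor_coeffs (deriv f) = seq_shift MacLane_weight (taylor_coeffs f)"
  by (simp add: taylor_coeffs_def seq_shift_def MacLane_weight_def funpow_Suc_right fun_eq_iff
      del: funpow.simps of_nat_Suc)

lemma deriv_entire: "f \<in> entire \<Longrightarrow> deriv f \<in> entire"
  by (simp add: entire_def holomorphic_deriv)

lemma backward_shift_on_entire_MacLane: "backward_shift_on_entire MacLane_weight"
  unfolding backward_shift_on_entire_def
proof (intro conjI ballI)
  show "weight MacLane_weight" by (simp add: weight_def MacLane_weight_def)
  fix f assume "f \<in> entire"
  then show "seq_shift MacLane_weight (taylor_coeffs f) \<in> taylor_coeffs ` entire"
    using deriv_entire taylor_coeffs_deriv by (metis imageI)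
qed

lemma backward_shift_MacLane:
  assumes "f \<in> entire"
  shows "backward_shift MacLane_weight f = deriv f"
  unfolding backward_shift_def taylor_coeffs_deriv[symmetric]
  using assms by (intro power_series_taylor_coeffs deriv_entire)

lemma weight_prod_MacLane: "weight_prod MacLane_weight n = fact n"
  by (induction n) (simp_all add: weight_prod_Suc MacLane_weight_def)

text \<open>The terms of the exponential series tend to 0, so every sufficiently late window
  works.\<close>

lemma superexponential_windows_fact: "superexponential_windows (\<lambda>n. fact n)"
  unfolding superexponential_windows_def
proof (intro allI impI)
  fix Q :: real and M N0 :: nat
  have "(\<lambda>n. inverse (fact n) * Q ^ n) \<longlonglongrightarrow> 0"
    by (rule summable_LIMSEQ_zero[OF summable_exp])
  then have "\<forall>\<^sub>F n in sequentially. inverse (fact n) * Q ^ n < 1"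
    by (rule order_tendstoD) simp
  then obtain N where "\<And>n. n \<ge> N \<Longrightarrow> inverse (fact n) * Q ^ n < 1"
    unfolding eventually_sequentially by blast
  then have "Q ^ n \<le> fact n" if "n \<ge> N" for n
    using that by (fastforce simp: field_simps)
  then show "\<exists>N\<ge>N0. \<forall>m<M. Q ^ (N + m) \<le> norm (fact (N + m) :: complex)"
    by (intro exI[of _ "max N N0"]) (auto simp: norm_fact)
qed

text \<open>The operators need only be compared along orbits of entire functions, which stay
  entire.\<close>

lemma HC_backward_shift_MacLane: "HC (backward_shift MacLane_weight) = HC deriv"
proof -
  have "(backward_shift MacLane_weight ^^ n) f = (deriv ^^ n) f" if "f \<in> entire" for f n
  proof (induction n)
    case (Suc n)
    have "(backward_shift MacLane_weight ^^ n) f \<in> entire"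
      using backward_shift_funpow(1)[OF backward_shift_on_entire_MacLane that] .
    with Suc show ?case by (simp add: backward_shift_MacLane)
  qed simp
  then show ?thesis unfolding HC_def by (intro Collect_cong conj_cong) simp_all
qed

theorem corollary2p9:
  "(\<forall>w. backward_shift_on_entire w \<and> hypercyclic (backward_shift w)
        \<longrightarrow> algebrable (HC (backward_shift w)))
   \<and> (backward_shift_on_entire MacLane_weight
      \<and> (\<forall>f\<in>entire. backward_shift MacLane_weight f = deriv f)
      \<and> hypercyclic deriv
      \<and> algebrable (HC deriv))"
proof (intro conjI allI impI ballI)
  fix w assume "backward_shift_on_entire w \<and> hypercyclic (backward_shift w)"
  then show "algebrable (HC (backward_shift w))"
    using hypercyclic_imp_superexponential_windows algebrable_HC_backward_shift
    unfolding hypercyclic_def by blast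
next
  have "superexponential_windows (weight_prod MacLane_weight)"
    using superexponential_windows_fact by (simp add: weight_prod_MacLane[abs_def])
  then show *: "algebrable (HC deriv)"
    using algebrable_HC_backward_shift[OF backward_shift_on_entire_MacLane]
    by (simp add: HC_backward_shift_MacLane)
  then show "hypercyclic deriv"
    unfolding hypercyclic_def by (rule algebrable_imp_nonempty)
qed (simp_all add: backward_shift_on_entire_MacLane backward_shift_MacLane)

end
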